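(* Let $n>1$ be an integer, let $p\in\mathbb{C}[z]$ be a polynomial of degree $n$, and let $c\in\mathbb{C}$. Suppose the anti-rational map $\overline{r}(z):=\overline{c}+1/\overline{p(z)}$ has $n$ (distinct) attracting fixed points. Then the forward orbit of $\infty$ under $\overline{r}$ is infinite; in particular $\overline{r}$ is not post-critically finite.
   Context: Write $r(z)=c+1/p(z)$, a rational map of degree $n$ of the Riemann sphere $\widehat{\mathbb{C}}=\mathbb{C}\cup\{\infty\}$, and $\overline{r}:\widehat{\mathbb{C}}\to\widehat{\mathbb{C}}$, $z\mapsto\overline{r(z)}$ (with $\overline{\infty}=\infty$). Since $r(\infty)=c\in\mathbb{C}$, every fixed point of $\overline{r}$ is finite; a fixed point $z_0$ of $\overline{r}$ is attracting if $|r'(z_0)|<1$ (with $r'(z_0)=0$ allowed). The critical points of $\overline{r}$ are the points of $\widehat{\mathbb{C}}$ where $r$ is not locally injective, and its critical values are the images of these points under $\overline{r}$. The forward orbit of a point $z$ is $\{\overline{r}^{\,d}(z): d\ge 0\}$, where $\overline{r}^{\,d}$ is the $d$-th iterate. The map $\overline{r}$ is post-critically finite if every critical value has finite forward orbit under $\overline{r}$. *)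

theory Defs
  imports "HOL-Complex_Analysis.Complex_Analysis" "HOL-Computational_Algebra.Computational_Algebra"
begin

text \<open>The Riemann sphere is the one-point compactification of the complex plane:
  \<^term>\<open>None\<close> is the point at infinity and \<^term>\<open>Some z\<close> is the finite point \<open>z\<close>.\<close>

type_synonym sphere = "complex option"

abbreviation sphere_top :: "sphere topology" where
  "sphere_top \<equiv> Alexandroff_compactification euclidean"

text \<open>The rational map \<open>r = c + 1/p\<close> on the sphere, for a nonconstant polynomial \<open>p\<close>: then
  \<open>p(\<infinity>) = \<infinity>\<close>, hence \<open>r(\<infinity>) = c\<close>. For constant \<open>p\<close> the value at infinity is not meaningful.\<close>

definition rat_map :: "complex \<Rightarrow> complex poly \<Rightarrow> sphere \<Rightarrow> sphere" where
  "rat_map c p w = (case w of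
      None \<Rightarrow> Some c
    | Some z \<Rightarrow> if poly p z = 0 then None else Some (c + 1 / poly p z))"

definition antirat_map :: "complex \<Rightarrow> complex poly \<Rightarrow> sphere \<Rightarrow> sphere" where
  "antirat_map c p w = map_option cnj (rat_map c p w)"

text \<open>Since infinity is mapped to a finite point, fixed points are finite and are represented by
  complex numbers. They are never zeros of \<open>p\<close>, so the derivative below is taken at a point
  where \<open>r\<close> is holomorphic.\<close>

definition attracting_fixed_points :: "complex \<Rightarrow> complex poly \<Rightarrow> complex set" where
  "attracting_fixed_points c p =
     {z. antirat_map c p (Some z) = Some z \<and> cmod (deriv (\<lambda>x. c + 1 / poly p x) z) < 1}"

definition forward_orbit :: "('a \<Rightarrow> 'a) \<Rightarrow> 'a \<Rightarrow> 'a set" where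
  "forward_orbit f x = {(f ^^ d) x | d. True}"

definition locally_injective_at :: "'a topology \<Rightarrow> ('a \<Rightarrow> 'b) \<Rightarrow> 'a \<Rightarrow> bool" where
  "locally_injective_at X f x \<longleftrightarrow> (\<exists>U. openin X U \<and> x \<in> U \<and> inj_on f U)"

definition critical_points :: "complex \<Rightarrow> complex poly \<Rightarrow> sphere set" where
  "critical_points c p = {w. \<not> locally_injective_at sphere_top (rat_map c p) w}"

definition critical_values :: "complex \<Rightarrow> complex poly \<Rightarrow> sphere set" where
  "critical_values c p = antirat_map c p ` critical_points c p"

definition post_critically_finite :: "complex \<Rightarrow> complex poly \<Rightarrow> bool" where
  "post_critically_finite c p \<longleftrightarrow>
     (\<forall>v \<in> critical_values c p. finite (forward_orbit (antirat_map c p) v))"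

end

theory Submission
  imports Defs
begin

text \<open>By a strong form of Fatou's theorem, each attracting fixed point either is itself a critical
  point or attracts a critical point whose orbit is infinite. The critical points are infinity and the at
  most \<open>n - 1\<close> zeros of \<open>p'\<close>, and different fixed points attract different critical points, so \<open>n\<close>
  attracting fixed points use up all of them. Infinity is therefore attracted by one of them, and it is
  not a fixed point, so its orbit is infinite.

  For Fatou's theorem, one extends the inverse branches of the iterates on a disc about the fixed point.
  A critical orbit may still land exactly on the fixed point, that is, on the centre of the disc.
  The branches take finite values only, since infinity cannot be met without \<open>cnj c\<close> being the
  centre; hence an extension step is a lift through the polynomial \<open>p\<close> of a map of the disc to the plane.\<close>

section \<open>Lifting through a polynomial\<close>

lemma card_roots_eq_degree:
  fixes p :: "complex poly"
  assumes "rsquarefree p"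
  shows "card {z. poly p z = 0} = degree p"
proof -
  have "p \<noteq> 0" using assms by (simp add: rsquarefree_def)
  have "degree p = degree (smult (lead_coeff p) (\<Prod>z|poly p z = 0. [:-z, 1:]))"
    using complex_poly_decompose_rsquarefree[OF assms] by simp
  also have "\<dots> = degree (\<Prod>z|poly p z = 0. [:-z, 1:])"
    using \<open>p \<noteq> 0\<close> by simp
  also have "\<dots> = card {z. poly p z = 0}"
    by (subst degree_prod_sum_eq) auto
  finally show ?thesis by simp
qed

lemma degree_diff_const: "degree (p - [:v:]) = degree (p :: complex poly)"
proof (cases "degree p = 0")
  case True
  then show ?thesis by (metis degree_eq_zeroE degree_pCons_0 diff_pCons diff_0_right)
next
  case False
  then show ?thesis
    by (metis degree_add_eq_left degree_minus degree_pCons_0 diff_conv_add_uminus gr0I)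
qed

text \<open>Over a noncritical value \<open>v\<close> the polynomial \<open>p - [:v:]\<close> shares
  no root with its derivative, so it is squarefree.\<close>

lemma card_poly_preimage:
  fixes p :: "complex poly"
  assumes "\<And>z. poly p z = v \<Longrightarrow> poly (pderiv p) z \<noteq> 0"
  shows "card {z. poly p z = v} = degree p"
proof -
  have "rsquarefree (p - [:v:])"
    using assms by (simp add: rsquarefree_roots pderiv_diff pderiv_pCons)
  from card_roots_eq_degree[OF this] show ?thesis
    by (simp add: degree_diff_const)
qed

lemma poly_preimage_bound:
  fixes p :: "complex poly"
  assumes "degree p > 0"
  shows "finite {z. poly p z = v}" "card {z. poly p z = v} \<le> degree p"
proof -
  have "p - [:v:] \<noteq> 0"
    using assms degree_diff_const[of p v] by force
  from poly_roots_finite[OF this] card_poly_roots_bound[OF this]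
  show "finite {z. poly p z = v}" "card {z. poly p z = v} \<le> degree p"
    by (simp_all add: degree_diff_const)
qed

lemma surj_poly_complex:
  fixes p :: "complex poly"
  assumes "degree p > 0"
  shows "surj (poly p)"
  unfolding surj_def
proof
  fix v
  have "\<not> constant (poly (p - [:v:]))"
    using assms by (simp only: constant_degree degree_diff_const)
  from fundamental_theorem_of_algebra[OF this] obtain z where "poly (p - [:v:]) z = 0" by blast
  then show "\<exists>z. v = poly p z" by (intro exI[of _ z]) simp
qed

lemma finite_poly_critical_values:
  fixes p :: "complex poly"
  assumes "degree p > 0"
  shows "finite (poly p ` {z. poly (pderiv p) z = 0})"
proof -
  have "pderiv p \<noteq> 0" using assms by (simp add: pderiv_eq_0_iff)
  then show ?thesis by (simp add: poly_roots_finite)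
qed

lemma poly_locally_injective:
  fixes p :: "complex poly"
  assumes "poly (pderiv p) a \<noteq> 0"
  obtains r where "r > 0" "inj_on (poly p) (ball a r)"
proof -
  have "deriv (poly p) a \<noteq> 0"
    using assms by (metis DERIV_imp_deriv poly_DERIV)
  then show ?thesis
    using has_complex_derivative_locally_injective[of "poly p" UNIV a] that
    by (auto simp: holomorphic_intros)
qed

section \<open>The covering defined by a polynomial\<close>

text \<open>Counting takes the place of properness: no fibre has more than \<open>degree p\<close>
  points, so disjoint discs about the \<open>degree p\<close> points over \<open>v\<close>, each
  covering a neighbourhood \<open>T\<close> of \<open>v\<close> injectively, already contain the
  whole preimage of \<open>T\<close>.\<close>

lemma poly_covering_space:
  fixes p :: "complex poly"
  assumes deg: "degree p > 0"
  defines "S \<equiv> - poly p ` {z. poly (pderiv p) z = 0}"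
  shows "covering_space (poly p -` S) (poly p) S"
proof
  show "continuous_on (poly p -` S) (poly p)" by (intro continuous_intros)
  show "poly p ` (poly p -` S) = S"
    using surj_poly_complex[OF deg] by (rule surj_image_vimage_eq)
next
  fix v assume v: "v \<in> S"
  have "open S"
    unfolding S_def using finite_poly_critical_values[OF deg] finite_imp_closed by blast
  define R where "R = {z. poly p z = v}"
  have cardR: "card R = degree p" and finR: "finite R"
    unfolding R_def using v poly_preimage_bound[OF deg]
    by (auto intro!: card_poly_preimage simp: S_def)
  have inj: "\<forall>a\<in>R. \<forall>\<^sub>F r in at_right 0. inj_on (poly p) (ball a r)"
  proof
    fix a assume "a \<in> R"
    then have "poly (pderiv p) a \<noteq> 0" using v by (auto simp: R_def S_def)
    then obtain r where "r > 0" "inj_on (poly p) (ball a r)"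
      by (rule poly_locally_injective)
    then show "\<forall>\<^sub>F r in at_right 0. inj_on (poly p) (ball a r)"
      unfolding eventually_at_right_field
      by (meson inj_on_subset less_imp_le subset_ball)
  qed
  have dis: "\<forall>a\<in>R. \<forall>b\<in>R. \<forall>\<^sub>F r in at_right 0. a \<noteq> b \<longrightarrow> ball a r \<inter> ball b r = {}"
  proof (intro ballI)
    fix a b
    show "\<forall>\<^sub>F r in at_right 0. a \<noteq> b \<longrightarrow> ball a r \<inter> ball b r = {}"
    proof (cases "a = b")
      case False
      have "ball a r \<inter> ball b r = {}" if "r < dist a b / 2" for r
        using that by (intro disjoint_ballI) auto
      moreover have "dist a b / 2 > 0" using False by simp
      ultimately show ?thesis
        unfolding eventually_at_right_field by blast
    qed auto
  qed
  have "\<forall>\<^sub>F r in at_right 0. (\<forall>a\<in>R. inj_on (poly p) (ball a r)) \<and>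
      (\<forall>a\<in>R. \<forall>b\<in>R. a \<noteq> b \<longrightarrow> ball a r \<inter> ball b r = {}) \<and> r > 0"
    using inj dis finR
    by (intro eventually_conj) (simp_all add: eventually_ball_finite eventually_at_right_less)
  from eventually_happens'[OF trivial_limit_at_right_real this]
  obtain r :: real where r: "r > 0" and inj: "\<And>a. a \<in> R \<Longrightarrow> inj_on (poly p) (ball a r)"
    and dis: "\<And>a b. a \<in> R \<Longrightarrow> b \<in> R \<Longrightarrow> a \<noteq> b \<Longrightarrow> ball a r \<inter> ball b r = {}"
    by blast
  define T where "T = S \<inter> (\<Inter>a\<in>R. poly p ` ball a r)"
  have "open (poly p ` ball a r)" if "a \<in> R" for a
    using inj[OF that] by (intro open_mapping_thm3) (auto intro!: holomorphic_intros)
  then have "open T"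
    unfolding T_def using finR \<open>open S\<close> by blast
  have "v \<in> T" using v r by (force simp: T_def R_def)
  define U where "U a = ball a r \<inter> poly p -` T" for a
  have opU: "open (U a)" for a
    unfolding U_def using \<open>open T\<close>
    by (intro open_Int open_ball open_vimage) (auto intro!: continuous_intros)
  have U: "poly p ` U a = T" "inj_on (poly p) (U a)" if "a \<in> R" for a
  proof -
    have "T \<subseteq> poly p ` ball a r" using that by (auto simp: T_def)
    then show "poly p ` U a = T" unfolding U_def by blast
    show "inj_on (poly p) (U a)"
      using inj[OF that] by (rule inj_on_subset) (auto simp: U_def)
  qed
  have "poly p -` T \<subseteq> \<Union>(U ` R)"
  proof
    fix z assume z: "z \<in> poly p -` T"
    have "\<exists>y\<in>U a. poly p y = poly p z" if "a \<in> R" for a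
    proof -
      have "poly p z \<in> poly p ` U a" using z U(1)[OF that] by simp
      then show ?thesis by (metis imageE)
    qed
    then obtain y where y: "\<And>a. a \<in> R \<Longrightarrow> y a \<in> U a" "\<And>a. a \<in> R \<Longrightarrow> poly p (y a) = poly p z"
      by metis
    \<comment> \<open>\<open>y\<close> picks one preimage of \<open>poly p z\<close> in each sheet.
      The sheets are disjoint, so these are \<open>degree p\<close> distinct points, hence the
      entire fibre, and \<open>z\<close> is one of them.\<close>
    have "inj_on y R"
      using y(1) dis by (intro inj_onI) (metis IntI U_def empty_iff IntD1)
    then have "card (y ` R) = degree p"
      by (simp add: card_image cardR)
    moreover have "y ` R \<subseteq> {w. poly p w = poly p z}" using y(2) by auto
    ultimately have "y ` R = {w. poly p w = poly p z}"
      using poly_preimage_bound[OF deg, of "poly p z"] by (metis card_seteq)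
    then have "z \<in> y ` R" by simp
    then obtain a where "a \<in> R" "z = y a" by (rule imageE)
    then show "z \<in> \<Union>(U ` R)" using y(1) by blast
  qed
  moreover have "T \<subseteq> S" by (auto simp: T_def)
  moreover have "\<Union>(U ` R) \<subseteq> poly p -` T" unfolding U_def by blast
  ultimately have "\<Union>(U ` R) = poly p -` S \<inter> poly p -` T" by blast
  moreover have "openin (top_of_set (poly p -` S)) u" if "u \<in> U ` R" for u
  proof (rule open_subset)
    show "open u" using that opU by blast
    show "u \<subseteq> poly p -` S" using that \<open>T \<subseteq> S\<close> unfolding U_def by blast
  qed
  moreover have "pairwise disjnt (U ` R)"
    unfolding pairwise_image using dis by (auto simp: pairwise_def disjnt_def U_def)
  moreover have "\<exists>q. homeomorphism u T (poly p) q" if "u \<in> U ` R" for u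
  proof -
    from that obtain a where a: "a \<in> R" "u = U a" by blast
    have "continuous_on (U a) (poly p)" by (intro continuous_intros)
    from invariance_of_domain_homeomorphism[OF opU this _ U(2)[OF a(1)]]
    obtain g where "homeomorphism (U a) (poly p ` U a) (poly p) g" by auto
    then show ?thesis using U(1) a by auto
  qed
  moreover have "openin (top_of_set S) T"
    using \<open>open T\<close> \<open>T \<subseteq> S\<close> by (rule open_subset[rotated])
  ultimately show "\<exists>T. v \<in> T \<and> openin (top_of_set S) T \<and>
      (\<exists>V. \<Union>V = poly p -` S \<inter> poly p -` T \<and> (\<forall>u\<in>V. openin (top_of_set (poly p -` S)) u) \<and>
        pairwise disjnt V \<and> (\<forall>u\<in>V. \<exists>q. homeomorphism u T (poly p) q))"
    using \<open>v \<in> T\<close> by (intro exI[of _ T] conjI exI[of _ "U ` R"]) auto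
qed

text \<open>Only the centre may be mapped to a critical value of the polynomial, so the lift exists on every
  half-disc; the half-disc lifts agree because each of them extends one local inverse branch.\<close>

lemma poly_lift_ball:
  fixes p :: "complex poly"
  assumes deg: "degree p > 0" and holq: "q holomorphic_on ball z0 \<rho>" and \<rho>: "\<rho> > 0"
    and a: "poly p a = q z0" "poly (pderiv p) a \<noteq> 0"
    and crit: "\<And>w z. w \<in> ball z0 \<rho> \<Longrightarrow> w \<noteq> z0 \<Longrightarrow> poly p z = q w \<Longrightarrow> poly (pderiv p) z \<noteq> 0"
  obtains L where "L holomorphic_on ball z0 \<rho>" "L z0 = a"
    "\<And>w. w \<in> ball z0 \<rho> \<Longrightarrow> poly p (L w) = q w"
proof -
  define S where "S = - poly p ` {z. poly (pderiv p) z = 0}"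
  define C where "C = poly p -` S"
  have cov: "covering_space C (poly p) S"
    unfolding C_def S_def by (rule poly_covering_space[OF deg])
  have "open S"
    unfolding S_def using finite_poly_critical_values[OF deg] finite_imp_closed by blast
  then have "open C"
    unfolding C_def by (rule open_vimage) (auto intro!: continuous_intros)
  have holp: "poly p holomorphic_on X" for X by (auto intro!: holomorphic_intros)
  have qS: "q w \<in> S" if "w \<in> ball z0 \<rho>" "w \<noteq> z0" for w
    using crit[OF that] by (force simp: S_def)
  have inC: "z \<in> C" if "poly p z = q w" "w \<in> ball z0 \<rho>" "w \<noteq> z0" for z w
    using qS[OF that(2,3)] that(1) by (simp add: C_def)
  obtain r where r: "r > 0" "inj_on (poly p) (ball a r)"
    using poly_locally_injective[OF a(2)] .
  obtain h where holh: "h holomorphic_on (poly p ` ball a r)"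
    and h: "\<And>z. z \<in> ball a r \<Longrightarrow> h (poly p z) = z"
    using holomorphic_has_inverse[OF holp open_ball r(2)] by metis
  have opV: "open (poly p ` ball a r)"
    using r(2) holp by (intro open_mapping_thm3) auto
  have contq: "continuous_on (ball z0 \<rho>) q"
    using holq by (rule holomorphic_on_imp_continuous_on)
  have "open (q -` (poly p ` ball a r) \<inter> ball z0 \<rho>)"
    using contq opV by (simp add: continuous_on_open_vimage)
  moreover have "z0 \<in> q -` (poly p ` ball a r) \<inter> ball z0 \<rho>"
    using r \<rho> a(1) by (auto intro!: image_eqI[of _ _ a])
  ultimately obtain \<epsilon> where \<epsilon>: "\<epsilon> > 0" "ball z0 \<epsilon> \<subseteq> q -` (poly p ` ball a r) \<inter> ball z0 \<rho>"
    by (meson open_contains_ball)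
  then have \<epsilon>\<rho>: "ball z0 \<epsilon> \<subseteq> ball z0 \<rho>" by blast
  \<comment> \<open>Near the centre the lift is the local inverse of \<open>poly p\<close> at
    \<open>a\<close>, applied to \<open>q\<close>. The covering does not serve there:
    \<open>q z0\<close> may be a critical value because of preimages other than
    \<open>a\<close>.\<close>
  define g where "g = h \<circ> q"
  have holg: "g holomorphic_on ball z0 \<epsilon>"
    unfolding g_def using \<epsilon>(2) \<epsilon>\<rho> holq holh
    by (intro holomorphic_on_compose_gen[where t = "poly p ` ball a r"])
      (auto intro: holomorphic_on_subset)
  have g: "poly p (g w) = q w" if "w \<in> ball z0 \<epsilon>" for w
  proof -
    from that \<epsilon>(2) obtain z where "z \<in> ball a r" "q w = poly p z" by blast
    then show ?thesis using h by (simp add: g_def)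
  qed
  have g0: "g z0 = a" using h[of a] r a by (simp add: g_def)

  \<comment> \<open>\<open>HD u\<close> is the open half-disc on the side of \<open>z0\<close> to
    which \<open>u\<close> points, empty for \<open>u = 0\<close>. It is convex, hence simply
    connected, and avoids the centre.\<close>
  define HD where "HD u = ball z0 \<rho> \<inter> {w. 0 < Re ((w - z0) * cnj u)}" for u
  have HD: "convex (HD u)" "open (HD u)" for u
  proof -
    have eq: "{w. 0 < Re ((w - z0) * cnj u)} = {w. u \<bullet> z0 < u \<bullet> w}"
      by (auto simp: inner_complex_def algebra_simps)
    show "convex (HD u)" "open (HD u)"
      unfolding HD_def eq using open_halfspace_gt[of "u \<bullet> z0" u] convex_halfspace_gt[of "u \<bullet> z0" u]
      by (auto intro!: convex_Int open_Int)
  qed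
  have HD_sub: "HD u \<subseteq> ball z0 \<rho> - {z0}" for u by (auto simp: HD_def)
  \<comment> \<open>Half-discs are stable under contraction towards \<open>z0\<close>, so a common
    point can be moved along its segment into the disc where \<open>g\<close> is defined.\<close>
  have HD_near: "\<exists>b. b \<in> HD u \<inter> HD v \<inter> ball z0 \<epsilon>" if "HD u \<inter> HD v \<noteq> {}" for u v
  proof -
    from that obtain w where w: "w \<in> HD u" "w \<in> HD v" by blast
    define t where "t = min 1 (\<epsilon> / (2 * cmod (w - z0)))"
    have "w \<noteq> z0" using w by (auto simp: HD_def)
    then have t: "t > 0" "t \<le> 1" "t * cmod (w - z0) < \<epsilon>"
      using \<epsilon>(1) by (auto simp: t_def min_def field_simps)
    define b where "b = z0 + of_real t * (w - z0)"
    have n: "dist z0 b = t * cmod (w - z0)"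
      using t(1) by (simp add: b_def dist_norm norm_mult)
    have "t * cmod (w - z0) \<le> cmod (w - z0)" using t by (simp add: mult_left_le_one_le)
    then have "b \<in> ball z0 \<rho>" using w n by (simp add: HD_def dist_norm norm_minus_commute)
    moreover have "Re ((b - z0) * cnj x) = t * Re ((w - z0) * cnj x)" for x
      by (simp add: b_def algebra_simps)
    ultimately have "b \<in> HD u \<inter> HD v \<inter> ball z0 \<epsilon>"
      using w n t by (simp add: HD_def)
    then show ?thesis by blast
  qed
  have "\<exists>l. l holomorphic_on HD u \<and> (\<forall>w\<in>HD u. poly p (l w) = q w) \<and>
      (\<forall>w\<in>HD u \<inter> ball z0 \<epsilon>. l w = g w)" for u
  proof (cases "HD u = {}")
    case False
    with HD_near[of u u] obtain b where b: "b \<in> HD u" "b \<in> ball z0 \<epsilon>" by blast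
    have gC: "g w \<in> C" if "w \<in> HD u" "w \<in> ball z0 \<epsilon>" for w
      using inC g that HD_sub by blast
    have qHD: "continuous_on (HD u) q" "q \<in> HD u \<rightarrow> S"
      using contq continuous_on_subset qS HD_sub by blast+
    obtain l where l: "continuous_on (HD u) l" "l \<in> HD u \<rightarrow> C" "l b = g b"
      "\<And>w. w \<in> HD u \<Longrightarrow> poly p (l w) = q w"
      by (rule covering_space_lift_strong[OF cov gC[OF b] b(1) convex_imp_simply_connected[OF HD(1)]
        convex_imp_locally_path_connected[OF HD(1)] qHD]) (use g[OF b(2)] in auto)
    have "q holomorphic_on HD u"
      using holq HD_sub by (meson Diff_subset holomorphic_on_subset order_trans)
    then have "l holomorphic_on HD u"
      using covering_space_lift_is_holomorphic[OF cov \<open>open C\<close> holp] qHD(2) l by blast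
    moreover have "l w = g w" if w: "w \<in> HD u \<inter> ball z0 \<epsilon>" for w
    proof (rule covering_space_lift_unique[where ?g1.0 = l and ?g2.0 = g and f = q and a = b
          and T = "HD u \<inter> ball z0 \<epsilon>", OF cov l(3)])
      show "continuous_on (HD u \<inter> ball z0 \<epsilon>) q" using qHD(1) continuous_on_subset by blast
      show "q \<in> HD u \<inter> ball z0 \<epsilon> \<rightarrow> S" using qHD(2) by blast
      show "continuous_on (HD u \<inter> ball z0 \<epsilon>) l" using l(1) continuous_on_subset by blast
      show "l \<in> HD u \<inter> ball z0 \<epsilon> \<rightarrow> C" using l(2) by blast
      show "continuous_on (HD u \<inter> ball z0 \<epsilon>) g"
        using holg holomorphic_on_imp_continuous_on continuous_on_subset by blast
      show "g \<in> HD u \<inter> ball z0 \<epsilon> \<rightarrow> C" using gC by blast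
      show "connected (HD u \<inter> ball z0 \<epsilon>)"
        by (intro convex_connected convex_Int HD convex_ball)
    qed (use b w l g in auto)
    ultimately show ?thesis using l by blast
  qed (auto simp: holomorphic_on_def)
  then obtain l where holl: "\<And>u. l u holomorphic_on HD u"
    and pl: "\<And>u w. w \<in> HD u \<Longrightarrow> poly p (l u w) = q w"
    and lg: "\<And>u w. w \<in> HD u \<Longrightarrow> w \<in> ball z0 \<epsilon> \<Longrightarrow> l u w = g w"
    by (metis IntI)
  \<comment> \<open>Both lifts equal \<open>g\<close> at a common point near the centre, and the
    intersection of two half-discs is connected, so lifts are unique on it.\<close>
  have l_eq: "l u w = l v w" if w: "w \<in> HD u" "w \<in> HD v" for u v w
  proof -
    from HD_near[of u v] w obtain b where b: "b \<in> HD u" "b \<in> HD v" "b \<in> ball z0 \<epsilon>" by blast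
    have eq: "l u b = l v b" using lg b by metis
    show ?thesis
    proof (rule covering_space_lift_unique[where ?g1.0 = "l u" and ?g2.0 = "l v" and f = q and a = b
          and T = "HD u \<inter> HD v", OF cov eq])
      show "continuous_on (HD u \<inter> HD v) q" using contq HD_sub continuous_on_subset by blast
      show "q \<in> HD u \<inter> HD v \<rightarrow> S" using qS HD_sub by blast
      show "continuous_on (HD u \<inter> HD v) (l u)" "continuous_on (HD u \<inter> HD v) (l v)"
        using holl holomorphic_on_imp_continuous_on continuous_on_subset by blast+
      show "l u \<in> HD u \<inter> HD v \<rightarrow> C" "l v \<in> HD u \<inter> HD v \<rightarrow> C"
        using inC[OF pl] HD_sub by blast+
      show "connected (HD u \<inter> HD v)"
        by (intro convex_connected convex_Int HD)
    qed (use b w pl in auto)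
  qed
  have self: "w \<in> HD (w - z0)" if "w \<in> ball z0 \<rho>" "w \<noteq> z0" for w
  proof -
    have "(w - z0) * cnj (w - z0) = of_real ((cmod (w - z0))\<^sup>2)"
      by (rule complex_norm_square[symmetric])
    then have "Re ((w - z0) * cnj (w - z0)) = (cmod (w - z0))\<^sup>2" by (metis Re_complex_of_real)
    then show ?thesis using that unfolding HD_def by (simp del: complex_cnj_diff times_complex.sel)
  qed
  define L where "L w = (if w = z0 then a else l (w - z0) w)" for w
  have L_g: "L w = g w" if "w \<in> ball z0 \<epsilon>" for w
  proof (cases "w = z0")
    case False
    then show ?thesis using lg[OF self that] \<epsilon>\<rho> that by (simp add: L_def subset_iff)
  qed (simp add: L_def g0)
  have L_l: "L w = l u w" if "w \<in> HD u" for u w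
  proof -
    have "w \<in> ball z0 \<rho>" "w \<noteq> z0" using that HD_sub by blast+
    then show ?thesis using l_eq[OF self that] by (simp add: L_def)
  qed
  have "L holomorphic_on ball z0 \<epsilon>"
    by (rule holomorphic_transform[OF holg]) (simp add: L_g)
  moreover have "L holomorphic_on HD u" for u
    by (rule holomorphic_transform[OF holl]) (simp add: L_l)
  ultimately have "L holomorphic_on (ball z0 \<epsilon> \<union> (\<Union>u. HD u))"
    using HD(2) by (intro holomorphic_on_Un holomorphic_on_UN_open) auto
  moreover have "ball z0 \<rho> \<subseteq> ball z0 \<epsilon> \<union> (\<Union>u. HD u)"
  proof
    fix w assume "w \<in> ball z0 \<rho>"
    then show "w \<in> ball z0 \<epsilon> \<union> (\<Union>u. HD u)"
      using self \<epsilon>(1) by (cases "w = z0") auto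
  qed
  ultimately have "L holomorphic_on ball z0 \<rho>" by (rule holomorphic_on_subset)
  moreover have "poly p (L w) = q w" if "w \<in> ball z0 \<rho>" for w
    using a(1) pl[OF self[OF that]] by (cases "w = z0") (simp_all add: L_def)
  moreover have "L z0 = a" by (simp add: L_def)
  ultimately show ?thesis using that by blast
qed

section \<open>Attracting fixed points\<close>

text \<open>Omitting \<open>ball b \<delta>\<close> bounds the reciprocal of \<open>h - b\<close> by
  \<open>1 / \<delta>\<close>. The Schwarz lemma gives that reciprocal a Lipschitz estimate at
  \<open>z0\<close> independent of \<open>h\<close>, and inversion is continuous at the nonzero
  point \<open>inverse (a - b)\<close>.\<close>

lemma omitted_disc_equicontinuous:
  fixes a b z0 :: complex
  assumes "\<rho> > 0" "\<delta> > 0" "\<epsilon> > 0" "a \<noteq> b"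
  obtains \<eta> where "\<eta> > 0"
    "\<And>h w. h holomorphic_on ball z0 \<rho> \<Longrightarrow> h z0 = a \<Longrightarrow>
      (\<And>w. w \<in> ball z0 \<rho> \<Longrightarrow> h w \<notin> ball b \<delta>) \<Longrightarrow> w \<in> ball z0 \<eta> \<Longrightarrow> h w \<in> ball a \<epsilon>"
proof -
  have "isCont inverse (inverse (a - b))"
    using \<open>a \<noteq> b\<close> by (intro continuous_intros) auto
  then obtain \<kappa> where \<kappa>: "\<kappa> > 0"
    "\<And>x. dist x (inverse (a - b)) < \<kappa> \<Longrightarrow> dist (inverse x) (a - b) < \<epsilon>"
    using \<open>\<epsilon> > 0\<close> unfolding continuous_at_eps_delta by (metis inverse_inverse_eq)
  \<comment> \<open>The Schwarz lemma will bound \<open>dist (g w) (g z0) * (\<delta> / 3)\<close>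
    by \<open>dist z0 w / \<rho>\<close>; the second entry of the minimum makes this less than
    \<open>\<kappa> * (\<delta> / 3)\<close>.\<close>
  define \<eta> where "\<eta> = min \<rho> (\<kappa> * \<delta> * \<rho> / 3)"
  have "h w \<in> ball a \<epsilon>"
    if hol: "h holomorphic_on ball z0 \<rho>" and h0: "h z0 = a"
      and omit: "\<And>w. w \<in> ball z0 \<rho> \<Longrightarrow> h w \<notin> ball b \<delta>" and w: "w \<in> ball z0 \<eta>" for h w
  proof -
    have far: "cmod (h x - b) \<ge> \<delta>" if "x \<in> ball z0 \<rho>" for x
      using omit[OF that] by (simp add: dist_norm norm_minus_commute)
    define g where "g x = inverse (h x - b)" for x
    have g: "cmod (g x) \<le> 1 / \<delta>" if "x \<in> ball z0 \<rho>" for x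
      using far[OF that] \<open>\<delta> > 0\<close> by (simp add: g_def norm_inverse inverse_eq_divide norm_divide frac_le)
    have holg: "g holomorphic_on ball z0 \<rho>"
      unfolding g_def using far \<open>\<delta> > 0\<close> by (intro holomorphic_intros hol) force
    \<comment> \<open>Two values of \<open>g\<close> differ by at most \<open>2 / \<delta>\<close>,
      so the factor \<open>\<delta> / 3\<close> keeps the modulus strictly below 1, as the Schwarz
      lemma demands.\<close>
    define f where "f \<zeta> = (g (z0 + of_real \<rho> * \<zeta>) - g z0) * of_real (\<delta> / 3)" for \<zeta>
    have inb: "z0 + of_real \<rho> * \<zeta> \<in> ball z0 \<rho>" if "cmod \<zeta> < 1" for \<zeta>
      using that \<open>\<rho> > 0\<close> by (simp add: dist_norm norm_mult)
    have "(\<lambda>\<zeta>. g (z0 + of_real \<rho> * \<zeta>)) holomorphic_on ball 0 1"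
      by (rule holomorphic_on_compose_gen[of "\<lambda>\<zeta>. z0 + of_real \<rho> * \<zeta>" _ g, unfolded o_def])
        (auto intro!: holomorphic_intros holg simp: inb simp del: mem_ball)
    then have holf: "f holomorphic_on ball 0 1"
      unfolding f_def by (intro holomorphic_intros)
    have fless: "cmod (f \<zeta>) < 1" if "cmod \<zeta> < 1" for \<zeta>
    proof -
      have "cmod (g (z0 + of_real \<rho> * \<zeta>) - g z0) \<le> 1 / \<delta> + 1 / \<delta>"
        using g[OF inb[OF that]] g[of z0] \<open>\<rho> > 0\<close> by (intro norm_triangle_le_diff add_mono) auto
      then have "cmod (f \<zeta>) \<le> (1 / \<delta> + 1 / \<delta>) * (\<delta> / 3)"
        unfolding f_def norm_mult using \<open>\<delta> > 0\<close> by (intro mult_mono) auto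
      then show ?thesis using \<open>\<delta> > 0\<close> by simp
    qed
    define \<zeta> where "\<zeta> = (w - z0) / of_real \<rho>"
    have n\<zeta>: "cmod \<zeta> = dist z0 w / \<rho>"
      using \<open>\<rho> > 0\<close> by (simp add: \<zeta>_def norm_divide dist_norm norm_minus_commute)
    have z\<zeta>: "z0 + of_real \<rho> * \<zeta> = w" using \<open>\<rho> > 0\<close> by (simp add: \<zeta>_def)
    have "cmod \<zeta> < 1" using w \<open>\<rho> > 0\<close> by (simp add: n\<zeta> \<eta>_def)
    have "f 0 = 0" by (simp add: f_def)
    from Schwarz_Lemma(1)[OF holf this fless \<open>cmod \<zeta> < 1\<close>] have "cmod (f \<zeta>) \<le> cmod \<zeta>" .
    then have "dist (g w) (g z0) * (\<delta> / 3) \<le> dist z0 w / \<rho>"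
      unfolding f_def z\<zeta> n\<zeta> norm_mult using \<open>\<delta> > 0\<close> by (simp add: dist_norm)
    also have "\<dots> < \<kappa> * (\<delta> / 3)"
      using w \<open>\<rho> > 0\<close> by (simp add: \<eta>_def field_simps)
    finally have "dist (g w) (inverse (a - b)) < \<kappa>"
      using \<open>\<delta> > 0\<close> h0 by (simp add: g_def)
    from \<kappa>(2)[OF this] show ?thesis by (simp add: g_def dist_norm norm_minus_commute)
  qed
  moreover have "\<eta> > 0" using \<kappa>(1) assms by (simp add: \<eta>_def)
  ultimately show ?thesis using that by blast
qed

section \<open>Contraction near an attracting fixed point\<close>

text \<open>Conjugation is an isometry, so the first-order expansion of
  \<open>c + 1 / poly p z\<close> at \<open>z0\<close> gives the contraction. If the derivative is
  nonzero, the expansion also bounds distances from below, so no other point of the disc is sent to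
  \<open>z0\<close>; this will show that an orbit hitting \<open>z0\<close> from within the disc
  started there.\<close>

lemma attracting_fixed_point_ball:
  assumes "z0 \<in> attracting_fixed_points c p"
  obtains R \<kappa> where "R > 0" "0 \<le> \<kappa>" "\<kappa> < 1"
    "\<And>z. z \<in> ball z0 R \<Longrightarrow> \<exists>u. antirat_map c p (Some z) = Some u \<and> dist z0 u \<le> \<kappa> * dist z0 z \<and>
      (poly (pderiv p) z0 \<noteq> 0 \<longrightarrow> u = z0 \<longrightarrow> z = z0)"
proof -
  define r where "r = (\<lambda>x. c + 1 / poly p x)"
  define D where "D = deriv r z0"
  have fp: "antirat_map c p (Some z0) = Some z0" and D1: "cmod D < 1"
    using assms by (auto simp: attracting_fixed_points_def D_def r_def)
  from fp have p0: "poly p z0 \<noteq> 0" and r0: "z0 = cnj (r z0)"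
    by (auto simp: antirat_map_def rat_map_def r_def split: if_splits)
  have der: "(r has_field_derivative (- poly (pderiv p) z0 / (poly p z0)\<^sup>2)) (at z0)"
    unfolding r_def using p0
    by (auto intro!: derivative_eq_intros poly_DERIV simp: power2_eq_square)
  then have D: "D = - poly (pderiv p) z0 / (poly p z0)\<^sup>2"
    unfolding D_def by (rule DERIV_imp_deriv)
  \<comment> \<open>The error \<open>e\<close> leaves \<open>cmod D + e\<close> below 1 as
    contraction factor and, for \<open>D \<noteq> 0\<close>, leaves \<open>cmod D - e\<close>
    positive for the lower bound.\<close>
  define e where "e = (if D = 0 then 1 / 2 else min ((1 - cmod D) / 2) (cmod D / 2))"
  have e: "e > 0" "cmod D + e < 1" "D \<noteq> 0 \<Longrightarrow> e < cmod D"
    using D1 zero_less_norm_iff[of D] by (auto simp: e_def min_def field_simps simp del: zero_less_norm_iff)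
  have "(r has_derivative (*) D) (at z0)"
    using der D by (simp add: has_field_derivative_def)
  then obtain d where d: "d > 0"
    "\<And>z. cmod (z - z0) < d \<Longrightarrow> cmod (r z - r z0 - D * (z - z0)) \<le> e * cmod (z - z0)"
    using e(1) unfolding has_derivative_at_alt by blast
  have "isCont (poly p) z0" by simp
  then obtain d' where d': "d' > 0" "\<And>z. dist z0 z < d' \<Longrightarrow> poly p z \<noteq> 0"
    using p0 continuous_at_avoid[of z0 "poly p" 0] by blast
  have "\<exists>u. antirat_map c p (Some z) = Some u \<and> dist z0 u \<le> (cmod D + e) * dist z0 z \<and>
      (poly (pderiv p) z0 \<noteq> 0 \<longrightarrow> u = z0 \<longrightarrow> z = z0)" if "z \<in> ball z0 (min d d')" for z
  proof (intro exI[of _ "cnj (r z)"] conjI impI)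
    have z: "cmod (z - z0) < d" "poly p z \<noteq> 0"
      using that d'(2) by (auto simp: dist_norm norm_minus_commute)
    show "antirat_map c p (Some z) = Some (cnj (r z))"
      using z(2) by (simp add: antirat_map_def rat_map_def r_def)
    have "dist z0 (cnj (r z)) = cmod (r z - r z0)"
      by (subst r0) (metis complex_cnj_diff complex_mod_cnj dist_commute dist_norm)
    also have "\<dots> \<le> cmod (r z - r z0 - D * (z - z0)) + cmod (D * (z - z0))"
      using norm_triangle_ineq[of "r z - r z0 - D * (z - z0)" "D * (z - z0)"] by simp
    also have "cmod (D * (z - z0)) = cmod D * dist z0 z"
      by (simp add: norm_mult dist_norm norm_minus_commute)
    also have "cmod (r z - r z0 - D * (z - z0)) \<le> e * dist z0 z"
      using d(2)[OF z(1)] by (simp add: dist_norm norm_minus_commute)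
    finally have "dist z0 (cnj (r z)) \<le> e * dist z0 z + cmod D * dist z0 z" by simp
    then show "dist z0 (cnj (r z)) \<le> (cmod D + e) * dist z0 z" by (simp add: distrib_right)
    assume "poly (pderiv p) z0 \<noteq> 0" and eq: "cnj (r z) = z0"
    then have "D \<noteq> 0" using D p0 by simp
    from eq r0 have "r z = r z0" by (metis complex_cnj_cnj)
    then have "(cmod D - e) * cmod (z - z0) \<le> 0"
      using d(2)[OF z(1)] by (simp add: norm_mult left_diff_distrib)
    with e(3)[OF \<open>D \<noteq> 0\<close>] show "z = z0"
      by (simp add: mult_le_0_iff)
  qed
  then show ?thesis
    using d(1) d'(1) e by (intro that[of "min d d'" "cmod D + e"]) auto
qed

lemma attracting_fixed_point_ball_funpow:
  assumes "z0 \<in> attracting_fixed_points c p"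
  obtains R \<kappa> where "R > 0" "0 \<le> \<kappa>" "\<kappa> < 1"
    "\<And>z k. z \<in> ball z0 R \<Longrightarrow>
      \<exists>u. (antirat_map c p ^^ k) (Some z) = Some u \<and> dist z0 u \<le> \<kappa> ^ k * dist z0 z \<and>
        (poly (pderiv p) z0 \<noteq> 0 \<longrightarrow> u = z0 \<longrightarrow> z = z0)"
proof -
  obtain R \<kappa> where R: "R > 0" and \<kappa>: "0 \<le> \<kappa>" "\<kappa> < 1"
    and step: "\<And>z. z \<in> ball z0 R \<Longrightarrow>
      \<exists>u. antirat_map c p (Some z) = Some u \<and> dist z0 u \<le> \<kappa> * dist z0 z \<and>
        (poly (pderiv p) z0 \<noteq> 0 \<longrightarrow> u = z0 \<longrightarrow> z = z0)"
    by (rule attracting_fixed_point_ball[OF assms]) blast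
  have "\<exists>u. (antirat_map c p ^^ k) (Some z) = Some u \<and> dist z0 u \<le> \<kappa> ^ k * dist z0 z \<and>
      (poly (pderiv p) z0 \<noteq> 0 \<longrightarrow> u = z0 \<longrightarrow> z = z0)" if z: "z \<in> ball z0 R" for z k
  proof (induction k)
    case 0
    then show ?case by simp
  next
    case (Suc k)
    then obtain u where u: "(antirat_map c p ^^ k) (Some z) = Some u"
      "dist z0 u \<le> \<kappa> ^ k * dist z0 z" "poly (pderiv p) z0 \<noteq> 0 \<longrightarrow> u = z0 \<longrightarrow> z = z0" by blast
    have "\<kappa> ^ k * dist z0 z \<le> dist z0 z"
      using \<kappa> by (simp add: mult_left_le_one_le power_le_one)
    with u(2) z have "u \<in> ball z0 R" by simp
    from step[OF this] obtain v where v: "antirat_map c p (Some u) = Some v"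
      "dist z0 v \<le> \<kappa> * dist z0 u" "poly (pderiv p) z0 \<noteq> 0 \<longrightarrow> v = z0 \<longrightarrow> u = z0" by blast
    have "\<kappa> * dist z0 u \<le> \<kappa> ^ Suc k * dist z0 z"
      using mult_left_mono[OF u(2) \<kappa>(1)] by (simp add: mult.assoc)
    with u v show ?case by auto
  qed
  with R \<kappa> that show ?thesis by blast
qed

section \<open>Attracted orbits and Fatou's theorem\<close>

text \<open>Convergence on the sphere to the finite point \<open>Some z\<close>, expressed through
  discs, which form a neighbourhood base there; the orbit may meet infinity finitely often.\<close>

definition attracted_to :: "(sphere \<Rightarrow> sphere) \<Rightarrow> complex \<Rightarrow> sphere \<Rightarrow> bool" where
  "attracted_to f z w \<longleftrightarrow>
     (\<forall>\<epsilon>>0. \<forall>\<^sub>F k in sequentially. (f ^^ k) w \<in> Some ` ball z \<epsilon>)"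

lemma attracted_to_unique:
  assumes "attracted_to f z w" "attracted_to f z' w"
  shows "z = z'"
proof (rule ccontr)
  assume "z \<noteq> z'"
  then have "dist z z' / 2 > 0" by simp
  then have "\<forall>\<^sub>F k in sequentially. (f ^^ k) w \<in> Some ` ball z (dist z z' / 2) \<and>
      (f ^^ k) w \<in> Some ` ball z' (dist z z' / 2)"
    using assms unfolding attracted_to_def by (intro eventually_conj) blast+
  from eventually_happens'[OF sequentially_bot this]
  obtain u where "dist z u < dist z z' / 2" "dist z' u < dist z z' / 2" by auto
  then show False using dist_triangle[of z z' u] by (simp add: dist_commute)
qed

text \<open>The points of a finite orbit other than \<open>z\<close> keep a positive distance from
  \<open>z\<close>, so convergence forces equality from some time on.\<close>

lemma attracted_to_finite_orbit:
  assumes att: "attracted_to f z w" and fin: "finite (forward_orbit f w)"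
  shows "\<forall>\<^sub>F k in sequentially. (f ^^ k) w = Some z"
proof -
  have "finite (Some -` forward_orbit f w)"
    using fin by (simp add: finite_vimageI)
  then obtain \<epsilon> where \<epsilon>: "\<epsilon> > 0" "\<And>u. Some u \<in> forward_orbit f w \<Longrightarrow> u \<noteq> z \<Longrightarrow> \<epsilon> \<le> dist z u"
    using finite_set_avoid[of "Some -` forward_orbit f w" z] by auto
  have "\<forall>\<^sub>F k in sequentially. (f ^^ k) w \<in> Some ` ball z \<epsilon>"
    using att \<epsilon>(1) unfolding attracted_to_def by blast
  then show ?thesis
  proof eventually_elim
    case (elim k)
    then obtain u where u: "(f ^^ k) w = Some u" "dist z u < \<epsilon>" by auto
    have "Some u \<in> forward_orbit f w"
      unfolding forward_orbit_def u(1)[symmetric] by blast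
    with \<epsilon>(2) u show ?case by force
  qed
qed

text \<open>A strong form of Fatou's theorem: inverse branches of all iterates exist on one disc about the
  fixed point unless a critical orbit with infinitely many points enters that disc, and they form an
  equicontinuous family because they omit a disc about the other attracting fixed point.\<close>

lemma attracts_infinite_critical_orbit:
  fixes c :: complex and p :: "complex poly"
  defines "F \<equiv> antirat_map c p"
  assumes deg: "degree p > 0"
    and z0: "z0 \<in> attracting_fixed_points c p" and z1: "z1 \<in> attracting_fixed_points c p"
    and "z0 \<noteq> z1" and nc: "poly (pderiv p) z0 \<noteq> 0"
  obtains w where "w \<in> insert None (Some ` {z. poly (pderiv p) z = 0})"
    "attracted_to F z0 w" "infinite (forward_orbit F w)"
proof (rule ccontr)
  note no_orbit = that
  assume "\<not> thesis"
  then have fin: "finite (forward_orbit F w)"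
    if "w \<in> insert None (Some ` {z. poly (pderiv p) z = 0})" "attracted_to F z0 w" for w
    using no_orbit that by blast
  obtain R \<kappa> where R: "R > 0" and \<kappa>: "0 \<le> \<kappa>" "\<kappa> < 1"
    and itR: "\<And>z k. z \<in> ball z0 R \<Longrightarrow> \<exists>u. (F ^^ k) (Some z) = Some u \<and>
      dist z0 u \<le> \<kappa> ^ k * dist z0 z \<and> (u = z0 \<longrightarrow> z = z0)"
    using attracting_fixed_point_ball_funpow[OF z0] nc unfolding F_def by metis
  obtain R1 \<kappa>1 where R1: "R1 > 0" and \<kappa>1: "0 \<le> \<kappa>1" "\<kappa>1 < 1"
    and itR1: "\<And>z k. z \<in> ball z1 R1 \<Longrightarrow> \<exists>u. (F ^^ k) (Some z) = Some u \<and>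
      dist z1 u \<le> \<kappa>1 ^ k * dist z1 z"
    using attracting_fixed_point_ball_funpow[OF z1] unfolding F_def by metis
  define \<rho> where "\<rho> = min R (dist z0 z1 / 2)"
  define \<delta> where "\<delta> = min R1 (dist z0 z1 / 2)"
  have \<rho>: "\<rho> > 0" "ball z0 \<rho> \<subseteq> ball z0 R" and \<delta>: "\<delta> > 0" "ball z1 \<delta> \<subseteq> ball z1 R1"
    using R R1 \<open>z0 \<noteq> z1\<close> by (auto simp: \<rho>_def \<delta>_def)
  have disj: "ball z0 \<rho> \<inter> ball z1 \<delta> = {}"
    by (rule disjoint_ballI) (auto simp: \<rho>_def \<delta>_def min_def)

  \<comment> \<open>If the orbit of infinity or of a zero of \<open>pderiv p\<close> enters the
    disc, it converges to \<open>z0\<close>, so by \<open>fin\<close> it is finite and eventually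
    equal to \<open>z0\<close>. Inside the disc only \<open>z0\<close> is sent to \<open>z0\<close>,
    so the point \<open>u\<close> is already \<open>z0\<close>.\<close>
  have land: "u = z0" if w: "w \<in> insert None (Some ` {z. poly (pderiv p) z = 0})"
    and wu: "(F ^^ k) w = Some u" and u: "u \<in> ball z0 \<rho>" for w k u
  proof -
    have uR: "u \<in> ball z0 R" using u \<rho>(2) by blast
    have "attracted_to F z0 w"
      unfolding attracted_to_def
    proof (intro allI impI)
      fix \<epsilon> :: real assume "\<epsilon> > 0"
      have "(\<lambda>j. \<kappa> ^ j * dist z0 u) \<longlonglongrightarrow> 0"
        using \<kappa> by (intro tendsto_mult_left_zero LIMSEQ_power_zero) auto
      then have "\<forall>\<^sub>F j in sequentially. \<kappa> ^ j * dist z0 u < \<epsilon>"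
        using \<open>\<epsilon> > 0\<close> by (rule order_tendstoD)
      then have "\<forall>\<^sub>F j in sequentially. (F ^^ (j + k)) w \<in> Some ` ball z0 \<epsilon>"
      proof eventually_elim
        case (elim j)
        obtain v where "(F ^^ j) (Some u) = Some v" "dist z0 v \<le> \<kappa> ^ j * dist z0 u"
          using itR[OF uR] by blast
        with elim wu show ?case by (simp add: funpow_add)
      qed
      then show "\<forall>\<^sub>F k in sequentially. (F ^^ k) w \<in> Some ` ball z0 \<epsilon>"
        by (rule eventually_sequentially_seg[THEN iffD1])
    qed
    from attracted_to_finite_orbit[OF this fin[OF w this]]
    have "\<forall>\<^sub>F j in sequentially. (F ^^ (j + k)) w = Some z0"
      by (rule eventually_sequentially_seg[THEN iffD2])
    from eventually_happens'[OF sequentially_bot this]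
    obtain j where "(F ^^ (j + k)) w = Some z0" by blast
    then have "(F ^^ j) (Some u) = Some z0" by (simp add: funpow_add wu)
    with itR[OF uR, of j] show ?thesis by auto
  qed

  have p0: "poly p z0 \<noteq> 0" and z0_eq: "z0 = cnj (c + 1 / poly p z0)"
    using z0 by (auto simp: attracting_fixed_points_def antirat_map_def rat_map_def split: if_splits)
  have F_eq: "F (Some z) = Some y" if "poly p z = 1 / (cnj y - c)" "y \<noteq> cnj c" for z y
    using that by (auto simp: F_def antirat_map_def rat_map_def)

  \<comment> \<open>\<open>h\<close> is an inverse branch of the \<open>k\<close>-th iterate. Each
    step conjugates, so branches alternate between holomorphic and antiholomorphic; the disjunction
    avoids tracking the parity of \<open>k\<close>.\<close>
  have branch: "\<exists>h. (h holomorphic_on ball z0 \<rho> \<or> (\<lambda>w. cnj (h w)) holomorphic_on ball z0 \<rho>) \<and>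
      h z0 = z0 \<and> (\<forall>w\<in>ball z0 \<rho>. (F ^^ k) (Some (h w)) = Some w)" for k
  proof (induction k)
    case 0
    show ?case by (rule exI[of _ "\<lambda>w. w"]) auto
  next
    case (Suc k)
    then obtain h where hol: "h holomorphic_on ball z0 \<rho> \<or> (\<lambda>w. cnj (h w)) holomorphic_on ball z0 \<rho>"
      and h0: "h z0 = z0" and inv: "\<And>w. w \<in> ball z0 \<rho> \<Longrightarrow> (F ^^ k) (Some (h w)) = Some w" by blast
    \<comment> \<open>Infinity is sent to \<open>cnj c\<close>, so a branch value
      \<open>cnj c\<close> would make the orbit of infinity reach \<open>w\<close>. By
      \<open>land\<close> then \<open>w = z0\<close>, hence \<open>z0 = cnj c\<close>, but
      \<open>1 / poly p z0\<close> is nonzero.\<close>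
    have hc: "h w \<noteq> cnj c" if w: "w \<in> ball z0 \<rho>" for w
    proof
      assume eq: "h w = cnj c"
      have "F None = Some (cnj c)" by (simp add: F_def antirat_map_def rat_map_def)
      then have "(F ^^ Suc k) None = Some w"
        using inv[OF w] eq by (simp add: funpow_Suc_right del: funpow.simps)
      from land[OF _ this w] have "w = z0" by blast
      with eq h0 have "z0 = cnj c" by simp
      then have "cnj c = cnj c + cnj (1 / poly p z0)" using z0_eq by (metis complex_cnj_add)
      then have "1 / poly p z0 = 0" by (metis add_cancel_left_right complex_cnj_zero_iff)
      with p0 show False by simp
    qed
    have hc': "cnj (h w) - c \<noteq> 0" if "w \<in> ball z0 \<rho>" for w
      using hc[OF that] by (metis complex_cnj_cnj right_minus_eq)
    \<comment> \<open>Solving \<open>F (Some z) = Some (h w)\<close> for \<open>poly p z\<close>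
      gives \<open>q w\<close>, so the next branch is a lift of \<open>q\<close> through
      \<open>p\<close>.\<close>
    define q where "q w = 1 / (cnj (h w) - c)" for w
    have qz0: "poly p z0 = q z0"
    proof -
      have "cnj z0 = c + 1 / poly p z0" using z0_eq by (metis complex_cnj_cnj)
      then show ?thesis by (simp add: q_def h0)
    qed
    have crit: "poly (pderiv p) z \<noteq> 0"
      if w: "w \<in> ball z0 \<rho>" "w \<noteq> z0" and z: "poly p z = q w" for w z
    proof
      assume "poly (pderiv p) z = 0"
      moreover have "(F ^^ Suc k) (Some z) = Some w"
        using F_eq[OF z[unfolded q_def] hc[OF w(1)]] inv[OF w(1)]
        by (simp add: funpow_Suc_right del: funpow.simps)
      ultimately have "w = z0" using land[of "Some z" "Suc k" w] w(1) by blast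
      with w(2) show False by simp
    qed
    have "\<exists>L. (L holomorphic_on ball z0 \<rho> \<or> (\<lambda>w. cnj (L w)) holomorphic_on ball z0 \<rho>) \<and>
        L z0 = z0 \<and> (\<forall>w\<in>ball z0 \<rho>. poly p (L w) = q w)"
      using hol
    proof
      assume "(\<lambda>w. cnj (h w)) holomorphic_on ball z0 \<rho>"
      then have holq: "q holomorphic_on ball z0 \<rho>"
        unfolding q_def by (intro holomorphic_intros hc')
      show ?thesis
        by (rule poly_lift_ball[OF deg holq \<rho>(1) qz0 nc crit]) blast+
    next
      assume h: "h holomorphic_on ball z0 \<rho>"
      \<comment> \<open>For holomorphic \<open>h\<close> the conjugate of \<open>q\<close> is
        holomorphic. It is lifted through the polynomial with conjugated coefficients, and the lift
        is conjugated back.\<close>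
      have cnj_q: "cnj (q w) = 1 / (h w - cnj c)" for w by (simp add: q_def)
      have hq: "(\<lambda>w. cnj (q w)) holomorphic_on ball z0 \<rho>"
        unfolding cnj_q using hc by (intro holomorphic_intros h) auto
      have deg': "degree (map_poly cnj p) > 0"
        using deg by (simp add: degree_map_poly)
      have pd: "pderiv (map_poly cnj p) = map_poly cnj (pderiv p)"
        by (intro poly_eqI) (simp add: coeff_pderiv coeff_map_poly)
      obtain L where L: "L holomorphic_on ball z0 \<rho>" "L z0 = cnj z0"
        "\<And>w. w \<in> ball z0 \<rho> \<Longrightarrow> poly (map_poly cnj p) (L w) = cnj (q w)"
      proof (rule poly_lift_ball[OF deg' hq \<rho>(1)])
        show "poly (map_poly cnj p) (cnj z0) = cnj (q z0)" using qz0 by simp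
        show "poly (pderiv (map_poly cnj p)) (cnj z0) \<noteq> 0" using nc by (simp add: pd)
        show "poly (pderiv (map_poly cnj p)) z \<noteq> 0"
          if "w \<in> ball z0 \<rho>" "w \<noteq> z0" "poly (map_poly cnj p) z = cnj (q w)" for w z
          using crit[OF that(1,2), of "cnj z"] that(3) by (simp add: pd)
      qed blast
      show ?thesis
      proof (intro exI[of _ "\<lambda>w. cnj (L w)"] conjI ballI disjI2)
        show "poly p (cnj (L w)) = q w" if "w \<in> ball z0 \<rho>" for w
          using L(3)[OF that] by simp
      qed (use L in auto)
    qed
    then obtain L where L: "L holomorphic_on ball z0 \<rho> \<or> (\<lambda>w. cnj (L w)) holomorphic_on ball z0 \<rho>"
      "L z0 = z0" "\<And>w. w \<in> ball z0 \<rho> \<Longrightarrow> poly p (L w) = q w" by blast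
    have "(F ^^ Suc k) (Some (L w)) = Some w" if w: "w \<in> ball z0 \<rho>" for w
      using F_eq[OF L(3)[OF w, unfolded q_def] hc[OF w]] inv[OF w]
      by (simp add: funpow_Suc_right del: funpow.simps)
    with L(1,2) show ?case by blast
  qed

  \<comment> \<open>Orbits from the disc about \<open>z1\<close> stay in it, so they never meet the
    disc about \<open>z0\<close>.\<close>
  have omit: "y \<notin> ball z1 \<delta>" if w: "w \<in> ball z0 \<rho>" and eq: "(F ^^ k) (Some y) = Some w" for y w k
  proof
    assume y: "y \<in> ball z1 \<delta>"
    then obtain u where u: "(F ^^ k) (Some y) = Some u" "dist z1 u \<le> \<kappa>1 ^ k * dist z1 y"
      using itR1 \<delta>(2) by blast
    have "\<kappa>1 ^ k * dist z1 y \<le> dist z1 y"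
      using \<kappa>1 by (simp add: mult_left_le_one_le power_le_one)
    with u eq y have "w \<in> ball z1 \<delta>" by simp
    with disj w show False by blast
  qed
  obtain \<eta>1 where \<eta>1: "\<eta>1 > 0"
    "\<And>h w. h holomorphic_on ball z0 \<rho> \<Longrightarrow> h z0 = z0 \<Longrightarrow>
      (\<And>w. w \<in> ball z0 \<rho> \<Longrightarrow> h w \<notin> ball z1 \<delta>) \<Longrightarrow> w \<in> ball z0 \<eta>1 \<Longrightarrow> h w \<in> ball z0 \<rho>"
    using omitted_disc_equicontinuous[OF \<rho>(1) \<delta>(1) \<rho>(1) \<open>z0 \<noteq> z1\<close>] by blast
  \<comment> \<open>Antiholomorphic branches are treated through their conjugates, which take the
    value \<open>cnj z0\<close> at the centre and omit the disc about \<open>cnj z1\<close>.\<close>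
  have "cnj z0 \<noteq> cnj z1" using \<open>z0 \<noteq> z1\<close> by simp
  then obtain \<eta>2 where \<eta>2: "\<eta>2 > 0"
    "\<And>h w. h holomorphic_on ball z0 \<rho> \<Longrightarrow> h z0 = cnj z0 \<Longrightarrow>
      (\<And>w. w \<in> ball z0 \<rho> \<Longrightarrow> h w \<notin> ball (cnj z1) \<delta>) \<Longrightarrow> w \<in> ball z0 \<eta>2 \<Longrightarrow> h w \<in> ball (cnj z0) \<rho>"
    using omitted_disc_equicontinuous[OF \<rho>(1) \<delta>(1) \<rho>(1)] by blast
  have cnj_ball: "cnj x \<in> ball (cnj y) e \<longleftrightarrow> x \<in> ball y e" for x y e
    by (simp add: dist_norm flip: complex_cnj_diff)
  define \<eta> where "\<eta> = min \<rho> (min \<eta>1 \<eta>2)"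
  have "\<eta> > 0" using \<rho>(1) \<eta>1(1) \<eta>2(1) by (simp add: \<eta>_def)
  \<comment> \<open>A point off the centre that does not depend on \<open>k\<close>. Every branch
    sends it into the disc, and \<open>k\<close> contractions lead from there back to
    \<open>w\<close>, which forces its distance from \<open>z0\<close> to be 0.\<close>
  define w where "w = z0 + of_real (\<eta> / 2)"
  have w: "w \<in> ball z0 \<rho>" "w \<in> ball z0 \<eta>1" "w \<in> ball z0 \<eta>2" and "w \<noteq> z0"
    using \<open>\<eta> > 0\<close> by (auto simp: w_def dist_norm \<eta>_def)
  have "dist z0 w \<le> \<kappa> ^ k * \<rho>" for k
  proof -
    obtain h where hol: "h holomorphic_on ball z0 \<rho> \<or> (\<lambda>w. cnj (h w)) holomorphic_on ball z0 \<rho>"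
      and h0: "h z0 = z0" and inv: "\<And>w. w \<in> ball z0 \<rho> \<Longrightarrow> (F ^^ k) (Some (h w)) = Some w"
      using branch[of k] by blast
    have om: "h x \<notin> ball z1 \<delta>" if "x \<in> ball z0 \<rho>" for x
      using that inv[OF that] by (rule omit)
    then have om': "cnj (h x) \<notin> ball (cnj z1) \<delta>" if "x \<in> ball z0 \<rho>" for x
      using that unfolding cnj_ball .
    from hol have hw: "h w \<in> ball z0 \<rho>"
    proof
      assume "h holomorphic_on ball z0 \<rho>"
      from \<eta>1(2)[OF this h0 om w(2)] show ?thesis by blast
    next
      assume "(\<lambda>w. cnj (h w)) holomorphic_on ball z0 \<rho>"
      from \<eta>2(2)[OF this _ om' w(3)] h0 show ?thesis unfolding cnj_ball by simp
    qed
    then obtain u where "(F ^^ k) (Some (h w)) = Some u" "dist z0 u \<le> \<kappa> ^ k * dist z0 (h w)"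
      using itR \<rho>(2) by blast
    with inv[OF w(1)] have "dist z0 w \<le> \<kappa> ^ k * dist z0 (h w)" by simp
    also have "\<dots> \<le> \<kappa> ^ k * \<rho>" using hw \<kappa> by (intro mult_left_mono) auto
    finally show ?thesis .
  qed
  moreover have "(\<lambda>k. \<kappa> ^ k * \<rho>) \<longlonglongrightarrow> 0"
    using \<kappa> by (intro tendsto_mult_left_zero LIMSEQ_power_zero) auto
  ultimately have "dist z0 w \<le> 0" by (intro LIMSEQ_le_const) auto
  with \<open>w \<noteq> z0\<close> show False by simp
qed

section \<open>Infinity as a critical point, and the count\<close>

text \<open>Neighbourhoods of infinity are complements of compact sets \<open>K\<close>. A nonzero
  noncritical value \<open>v\<close> outside the image of \<open>K\<close> has
  \<open>degree p > 1\<close> preimages, all outside \<open>K\<close> and none a pole, and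
  \<open>rat_map c p\<close> takes one value at all of them.\<close>

lemma None_in_critical_points:
  assumes "degree p > 1"
  shows "None \<in> critical_points c p"
proof -
  have "\<not> inj_on (rat_map c p) U" if opU: "openin sphere_top U" and "None \<in> U" for U
  proof
    assume inj: "inj_on (rat_map c p) U"
    from opU \<open>None \<in> U\<close> obtain K where K: "compact K" "U = insert None (Some ` (- K))"
      by (auto simp: openin_Alexandroff_compactification Compl_eq_Diff_UNIV)
    have "compact (poly p ` K)"
      using K(1) by (intro compact_continuous_image) (auto intro!: continuous_intros)
    moreover have "finite (poly p ` {z. poly (pderiv p) z = 0})"
      using assms by (intro finite_poly_critical_values) simp
    ultimately have "bounded (insert 0 (poly p ` K \<union> poly p ` {z. poly (pderiv p) z = 0}))"
      by (simp add: compact_imp_bounded finite_imp_bounded)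
    then obtain v where v: "v \<notin> insert 0 (poly p ` K \<union> poly p ` {z. poly (pderiv p) z = 0})"
      by (metis UNIV_eq_I not_bounded_UNIV)
    have "card {z. poly p z = v} = degree p"
      using v by (intro card_poly_preimage) auto
    then have "\<not> card {z. poly p z = v} \<le> Suc 0" "finite {z. poly p z = v}"
      using assms by (auto intro: card_ge_0_finite)
    then obtain x y where xy: "poly p x = v" "poly p y = v" "x \<noteq> y"
      by (auto simp: card_le_Suc0_iff_eq)
    have "v \<notin> poly p ` K" using v by simp
    then have "x \<notin> K" "y \<notin> K" using xy by (metis imageI)+
    then have "Some x \<in> U" "Some y \<in> U" unfolding K(2) by blast+
    moreover have "rat_map c p (Some x) = rat_map c p (Some y)"
      using xy by (simp add: rat_map_def)
    ultimately have "Some x = Some y" using inj inj_onD by metis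
    with xy(3) show False by simp
  qed
  then show ?thesis by (auto simp: critical_points_def locally_injective_at_def)
qed

theorem proposition5p1:
  fixes n :: nat and p :: "complex poly" and c :: complex
  assumes "n > 1"
    and "degree p = n"
    and "\<exists>A. A \<subseteq> attracting_fixed_points c p \<and> finite A \<and> card A = n"
  shows "infinite (forward_orbit (antirat_map c p) None) \<and> \<not> post_critically_finite c p"
proof -
  define F where "F = antirat_map c p"
  define K where "K = insert None (Some ` {z. poly (pderiv p) z = 0})"
  obtain A where A: "A \<subseteq> attracting_fixed_points c p" "finite A" "card A = n"
    using assms(3) by blast
  have deg: "degree p > 0" using assms by simp
  have "\<exists>w. w \<in> K \<and> attracted_to F z w \<and> (w = Some z \<or> infinite (forward_orbit F w))"
    if z: "z \<in> A" for z
  proof (cases "poly (pderiv p) z = 0")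
    \<comment> \<open>A fixed point that is a zero of \<open>pderiv p\<close> serves as its own
      critical point; its orbit is constant, hence the alternative
      \<open>w = Some z\<close>.\<close>
    case True
    have "F (Some z) = Some z"
      using z A(1) by (auto simp: F_def attracting_fixed_points_def)
    then have "(F ^^ k) (Some z) = Some z" for k by (induction k) auto
    then have "attracted_to F z (Some z)" by (simp add: attracted_to_def)
    with True show ?thesis by (auto simp: K_def)
  next
    case False
    \<comment> \<open>Since \<open>n > 1\<close>, there is another attracting fixed point, as
      Fatou's theorem requires here.\<close>
    have "\<not> A \<subseteq> {z}"
      using A assms(1) card_mono[of "{z}" A] by auto
    then obtain z' where "z' \<in> A" "z \<noteq> z'" by blast
    with attracts_infinite_critical_orbit[OF deg _ _ _ False, of c z'] z A(1)
    show ?thesis unfolding F_def K_def by (metis subsetD)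
  qed
  then obtain W where W: "\<And>z. z \<in> A \<Longrightarrow> W z \<in> K"
    "\<And>z. z \<in> A \<Longrightarrow> attracted_to F z (W z)"
    "\<And>z. z \<in> A \<Longrightarrow> W z = Some z \<or> infinite (forward_orbit F (W z))"
    by metis
  have "inj_on W A"
    using W(2) attracted_to_unique by (metis inj_onI)
  then have "card (W ` A) = n" using A(3) by (simp add: card_image)
  \<comment> \<open>\<open>pderiv p\<close> has at most \<open>n - 1\<close> zeros and infinity adds
    one, so the injective \<open>W\<close> exhausts \<open>K\<close>.\<close>
  moreover have "finite K" "card K \<le> n"
  proof -
    have "pderiv p \<noteq> 0" using deg by (simp add: pderiv_eq_0_iff)
    then have fin: "finite {z. poly (pderiv p) z = 0}" and
      "card {z. poly (pderiv p) z = 0} \<le> degree (pderiv p)"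
      by (simp_all add: poly_roots_finite card_poly_roots_bound)
    then show "finite K" "card K \<le> n"
      using assms(1,2) card_image_le[OF fin, of Some]
      by (auto simp: K_def degree_pderiv card_insert_if)
  qed
  ultimately have "W ` A = K" using W(1) by (intro card_seteq) auto
  then have "None \<in> W ` A" by (simp add: K_def)
  then obtain z where "z \<in> A" "W z = None" by (metis imageE)
  with W(3)[of z] have inf: "infinite (forward_orbit F None)" by simp
  \<comment> \<open>Post-critical finiteness concerns critical values, so the orbit is restarted at
    \<open>F None\<close>; this loses at most the point at infinity.\<close>
  have "forward_orbit F None \<subseteq> insert None (forward_orbit F (F None))"
  proof
    fix x assume "x \<in> forward_orbit F None"
    then obtain d where x: "x = (F ^^ d) None" by (auto simp: forward_orbit_def)
    show "x \<in> insert None (forward_orbit F (F None))"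
      by (cases d) (auto simp: x forward_orbit_def funpow_Suc_right simp del: funpow.simps(2))
  qed
  with inf have "infinite (forward_orbit F (F None))"
    using finite_subset by blast
  moreover have "F None \<in> critical_values c p"
    using None_in_critical_points[of p c] assms by (auto simp: critical_values_def F_def)
  ultimately have "\<not> post_critically_finite c p"
    by (auto simp: post_critically_finite_def F_def)
  with inf show ?thesis by (simp add: F_def)
qed

end
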